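(* Let $t_1,t_2,t_3$ and $h_i,l_i,\tilde h_i,\tilde l_i$ ($i=1,2,3$), $\alpha,\tilde\alpha,\beta,\tilde\beta,\mu_0,\mu,\chi,\nu$ be complex parameters satisfying \begin{gather*} \chi = \big( \tilde{h}_1 + \tilde{h}_2 + \tilde{h}_3 - \tilde{l}_1 - \tilde{l}_2 - \tilde{l}_3 - \tilde{\beta } \big)/2 , \qquad \nu = 2 \mu _0 + \alpha - \tilde{\alpha } + \chi ,\qquad \mu = \mu _0 + \chi +1, \\ \beta = -\tilde{\beta } - \chi , \qquad l_i = \tilde{h}_i +\mu _0 , \qquad h_i = \tilde{l}_i +\mu _0 +\chi , \qquad i=1,2,3. \end{gather*} Let $P_{\mu,\mu_0}(x,s)$ be a function satisfying \begin{gather*} P_{\mu ,\mu _0} (x,s/q)= P_{\mu ,\mu _0 } (qx,s) = \frac{x-q^{\mu -1 }s}{x-q^{\mu _0 -1} s} P_{\mu ,\mu _0 } (x,s), \\ P_{\mu ,\mu _0 } (x,qs)= P_{\mu ,\mu _0 } (x/q,s) = \frac{x-q^{\mu _0 } s}{x-q^{\mu }s} P_{\mu ,\mu _0 } (x,s) . \end{gather*} Then \begin{gather*} A^{\langle 3 \rangle} ( x; h_1, h_2, h_3, l_1, l_2, l_3, \alpha , \beta )\, x^{-\alpha } s^{\chi +1 - \tilde{\alpha }} P_{\mu ,\mu _0 } (x,s) \\ = q^{\nu } A^{\langle 3 \rangle} \big( s; \tilde{h}_1, \tilde{h}_2, \tilde{h}_3, \tilde{l}_1, \tilde{l}_2,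 \tilde{l}_3, \tilde{\alpha } , \tilde{\beta }\big)\, x^{-\alpha } s^{\chi +1 - \tilde{\alpha }} P_{\mu ,\mu _0 } (x,s). \end{gather*}
   Context: $q$ is a complex number with $0<|q|<1$. Complex powers are taken with a fixed branch of $\log q$, so that $q^a=\exp(a\log q)$ and power functions obey $(q^{\pm1}x)^a=q^{\pm a}x^a$. Identities are understood at points where all expressions are defined. $T_x^{\pm1}$ is the $q$-shift operator in $x$, $T_x^{\pm1}g(x)=g(q^{\pm1}x)$, acting on the variable $x$ only (similarly $T_s^{\pm 1}$). With fixed complex parameters $t_1,t_2,t_3$ (the same for both operators), the operator $A^{\langle 3\rangle}$ is \begin{gather*} A^{\langle 3 \rangle} ( x; h_1, h_2, h_3, l_1, l_2, l_3, \alpha , \beta ) = x^{-1} \prod_{n=1}^3 (x- q^{h_n+1/2} t_n) T_{x}^{-1} + q^{2\alpha +1} x^{-1} \prod_{n=1}^3 (x- q^{l_n -1/2} t_n ) T_x \\ {} + q^{\alpha +1/2} \Big[ -(q^{1/2} +q^{-1/2} ) x^2 +\sum _{n=1}^3 ( q^{h_n} + q^{l_n} )t_n x + q^{(l_1 +l_2 +l_3 +h_1 +h_2 +h_3)/2} ( q^{\beta/2} + q^{-\beta/2} ) t_1 t_2 t_3 x^{-1} \Big]. \end{gather*} $A^{\langle 3 \rangle}(s;\dots)$ is the same operator with $x$ replaced by $s$ and $T_x$ by $T_s$. *)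

theory Defs
  imports Complex_Main
begin

text \<open>
  A complex number \<open>q \<noteq> 0\<close> comes with a fixed choice \<open>lq\<close> of its logarithm (\<open>exp lq = q\<close>);
  all powers of \<open>q\<close> are taken with respect to \<open>lq\<close>.
\<close>

definition qpow :: "complex \<Rightarrow> complex \<Rightarrow> complex" where
  "qpow lq a = exp (a * lq)"

text \<open>
  Power functions \<open>x\<^sup>a = exp (a * L x)\<close> must obey \<open>(q\<^sup>\<plusminus>\<^sup>1 x)\<^sup>a = q\<^sup>\<plusminus>\<^sup>a x\<^sup>a\<close>. The principal branch of the
  logarithm does not have this property, so \<open>L\<close> is a branch of the logarithm on some set \<open>X\<close>
  stable under multiplication by \<open>q\<^sup>\<plusminus>\<^sup>1\<close> (for instance a \<open>q\<close>-spiral) which is compatible with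
  the chosen logarithm \<open>lq\<close> of \<open>q\<close>. Such an \<open>X\<close> cannot contain \<open>0\<close>, since \<open>exp\<close> has no zeros.
\<close>

definition q_log_branch :: "complex \<Rightarrow> complex \<Rightarrow> complex set \<Rightarrow> (complex \<Rightarrow> complex) \<Rightarrow> bool" where
  "q_log_branch q lq X L \<longleftrightarrow>
     (\<forall>x\<in>X. exp (L x) = x
        \<and> q * x \<in> X \<and> L (q * x) = L x + lq
        \<and> inverse q * x \<in> X \<and> L (inverse q * x) = L x - lq)"

definition branch_pow :: "(complex \<Rightarrow> complex) \<Rightarrow> complex \<Rightarrow> complex \<Rightarrow> complex" where
  "branch_pow L x a = exp (a * L x)"

definition qshift :: "complex \<Rightarrow> (complex \<Rightarrow> complex) \<Rightarrow> complex \<Rightarrow> complex" where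
  "qshift q g x = g (q * x)"

definition qshift_inv :: "complex \<Rightarrow> (complex \<Rightarrow> complex) \<Rightarrow> complex \<Rightarrow> complex" where
  "qshift_inv q g x = g (inverse q * x)"

text \<open>
  The parameter triples \<open>t\<close>, \<open>h\<close>, \<open>l\<close> are functions of which only the values at \<open>1, 2, 3\<close> matter.
\<close>

definition A3 :: "complex \<Rightarrow> complex \<Rightarrow> (nat \<Rightarrow> complex) \<Rightarrow> (nat \<Rightarrow> complex) \<Rightarrow> (nat \<Rightarrow> complex)
    \<Rightarrow> complex \<Rightarrow> complex \<Rightarrow> (complex \<Rightarrow> complex) \<Rightarrow> complex \<Rightarrow> complex" where
  "A3 q lq t h l \<alpha> \<beta> g x =
     inverse x * (\<Prod>n=1..3. x - qpow lq (h n + 1/2) * t n) * qshift_inv q g x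
     + qpow lq (2 * \<alpha> + 1) * inverse x * (\<Prod>n=1..3. x - qpow lq (l n - 1/2) * t n) * qshift q g x
     + qpow lq (\<alpha> + 1/2) *
         (- (qpow lq (1/2) + qpow lq (- 1/2)) * x ^ 2
          + (\<Sum>n=1..3. (qpow lq (h n) + qpow lq (l n)) * t n) * x
          + qpow lq ((l 1 + l 2 + l 3 + h 1 + h 2 + h 3) / 2)
              * (qpow lq (\<beta> / 2) + qpow lq (- \<beta> / 2)) * t 1 * t 2 * t 3 * inverse x) * g x"

text \<open>
  The defining relations of \<open>P\<^sub>\<mu>\<^sub>,\<^sub>\<mu>\<^sub>0\<close>. The set \<open>D\<close> is the domain of definition of \<open>P\<close> (natural
  solutions are quotients of infinite products and have poles); a relation is required exactly
  where all the values of \<open>P\<close> in it are defined and its denominator does not vanish.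
\<close>

definition P_relations :: "complex \<Rightarrow> complex \<Rightarrow> complex \<Rightarrow> complex \<Rightarrow> (complex \<times> complex) set
    \<Rightarrow> (complex \<Rightarrow> complex \<Rightarrow> complex) \<Rightarrow> bool" where
  "P_relations q lq \<mu> \<mu>0 D P \<longleftrightarrow>
     (\<forall>x s. (x, s) \<in> D \<and> (x, s / q) \<in> D \<and> (q * x, s) \<in> D
            \<and> x - qpow lq (\<mu>0 - 1) * s \<noteq> 0 \<longrightarrow>
        P x (s / q) = P (q * x) s \<and>
        P (q * x) s = (x - qpow lq (\<mu> - 1) * s) / (x - qpow lq (\<mu>0 - 1) * s) * P x s)
   \<and> (\<forall>x s. (x, s) \<in> D \<and> (x, q * s) \<in> D \<and> (x / q, s) \<in> D
            \<and> x - qpow lq \<mu> * s \<noteq> 0 \<longrightarrow>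
        P x (q * s) = P (x / q) s \<and>
        P (x / q) s = (x - qpow lq \<mu>0 * s) / (x - qpow lq \<mu> * s) * P x s)"

end

theory Submission
  imports Defs
begin

text \<open>
  Both sides are a multiple of the common value
  \<open>x\<^bsup>-\<alpha>\<^esup> s\<^bsup>\<chi>+1-\<alpha>'\<^esup> P(x,s)\<close>, so the claim reduces to an identity
  between rational functions of \<open>x\<close> and \<open>s\<close>. The relations of \<open>P\<close> are such that \<open>T\<^sub>x\<^sup>-\<^sup>1\<close> and
  \<open>T\<^sub>s\<close> produce the same factor \<open>F = (x - m s) / (x - M s)\<close>, while \<open>T\<^sub>x\<close> and \<open>T\<^sub>s\<^sup>-\<^sup>1\<close> produce the
  same factor \<open>G = (x - m c s) / (x - N s)\<close>, where \<open>m = q\<^bsup>\<mu>0\<^esup>\<close>, \<open>c = q\<^sup>\<chi>\<close>, \<open>M = q\<^sup>\<mu> = m c q\<close> and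
  \<open>N = m / q\<close>. Hence the difference of the two sides has, apart from \<open>x = 0\<close> and \<open>s = 0\<close>, only two
  possible poles, at \<open>x = M s\<close> and at \<open>x = N s\<close>.

  Each pole cancels for the same reason. The cubic coefficients that multiply \<open>F\<close> combine to
  \<open>x\<^sup>-\<^sup>1 \<Prod>(x - M v\<^sub>n) - M\<^sup>2 s\<^sup>-\<^sup>1 \<Prod>(s - v\<^sub>n)\<close> with \<open>v\<^sub>n = q\<^bsup>l'\<^sub>n-1/2\<^esup> t\<^sub>n\<close>; those that multiply \<open>G\<close>
  combine to \<open>q\<close> times the same expression with \<open>N\<close> in place of \<open>M\<close> and \<open>v\<^sub>n = q\<^bsup>h'\<^sub>n+1/2\<^esup> t\<^sub>n\<close>.
  The expression vanishes at \<open>x = M s\<close> by homogeneity, so \<open>x - M s\<close> divides it,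
  with the explicit quotient of \<open>cubic_difference_factor\<close>. What remains has no poles off \<open>x s = 0\<close>,
  and it is cancelled by the multiplication parts of the two operators
  (\<open>cubic_kernel_identity\<close>). For the coefficients of \<open>x\<^sup>-\<^sup>1\<close> and \<open>s\<^sup>-\<^sup>1\<close> this is exactly what the
  values of \<open>\<chi>\<close> and \<open>\<beta>\<close> achieve: they turn the halved exponents into the products of the
  \<open>q\<close>-powers of the \<open>h'\<close> and of the \<open>l'\<close>.
\<close>

section \<open>Powers of q and compatible branches\<close>

lemma qpow_add: "qpow lq (a + b) = qpow lq a * qpow lq b"
  by (simp add: qpow_def distrib_right exp_add)

lemma qpow_minus: "qpow lq (- a) = inverse (qpow lq a)"
  by (simp add: qpow_def exp_minus)

lemma qpow_diff: "qpow lq (a - b) = qpow lq a / qpow lq b"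
  by (simp add: qpow_def left_diff_distrib exp_diff)

lemma qpow_numeral_mult: "qpow lq (numeral k * a) = qpow lq a ^ numeral k"
  using exp_of_nat_mult[of "numeral k" "a * lq"] by (simp add: qpow_def mult.assoc)

lemma qpow_nonzero: "qpow lq a \<noteq> 0"
  by (simp add: qpow_def)

lemma q_log_branch_nonzero:
  assumes "q_log_branch q lq X L" and "x \<in> X"
  shows "x \<noteq> 0"
  using assms by (metis exp_not_eq_zero q_log_branch_def)

lemma branch_pow_shift:
  assumes "q_log_branch q lq X L" and "x \<in> X"
  shows "branch_pow L (q * x) a = qpow lq a * branch_pow L x a"
  using assms by (simp add: q_log_branch_def branch_pow_def qpow_def distrib_left exp_add)

lemma branch_pow_shift_inv:
  assumes "q_log_branch q lq X L" and "x \<in> X"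
  shows "branch_pow L (inverse q * x) a = inverse (qpow lq a) * branch_pow L x a"
proof -
  have "L (inverse q * x) = L x - lq"
    using assms by (simp add: q_log_branch_def)
  then show ?thesis
    by (simp add: branch_pow_def qpow_def right_diff_distrib exp_diff divide_inverse)
qed

section \<open>The underlying rational identity\<close>

lemma sum_1_3: "(\<Sum>n=1..3. f n) = f 1 + f 2 + f (3::nat)"
  by (simp add: eval_nat_numeral)

lemma prod_1_3: "(\<Prod>n=1..3. f n) = f 1 * f 2 * f (3::nat)"
  by (simp add: eval_nat_numeral)

text \<open>
  The \<open>e\<^sub>2\<close> terms of the two products are the same and drop out, so the quotient involves only the
  first and the third elementary symmetric function of the roots.
\<close>

lemma cubic_difference_factor:
  fixes x s M u v w :: "'a :: field"
  assumes "x \<noteq> 0" and "s \<noteq> 0"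
  shows "(x - M * u) * (x - M * v) * (x - M * w) / x - M^2 * ((s - u) * (s - v) * (s - w)) / s
       = (x - M * s) * (x + M * s - M * (u + v + w) + M^2 * (u * v * w) / (x * s))"
  using assms by (simp add: field_simps) algebra

text \<open>
  Here \<open>a\<close> is \<open>q\<^bsup>1/2\<^esup>\<close>, and \<open>H\<^sub>i\<close>, \<open>L\<^sub>i\<close> stand for \<open>q\<^bsup>h'\<^sub>i\<^esup> t\<^sub>i\<close>, \<open>q\<^bsup>l'\<^sub>i\<^esup> t\<^sub>i\<close>. The common factor
  \<open>q\<^sup>\<alpha>\<close> of the two sides is already divided out.
\<close>

lemma cubic_kernel_identity:
  fixes x s a m c H1 H2 H3 L1 L2 L3 :: "'a :: field"
  assumes nz: "x \<noteq> 0" "s \<noteq> 0" "a \<noteq> 0"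
    and pM: "x - m * c * a^2 * s \<noteq> 0" and pN: "x - m / a^2 * s \<noteq> 0"
  defines "F \<equiv> (x - m * s) / (x - m * c * a^2 * s)"
    and "G \<equiv> (x - m * c * s) / (x - m / a^2 * s)"
  shows "(x - m * c * a * L1) * (x - m * c * a * L2) * (x - m * c * a * L3) / x * F
       + a^2 * ((x - m / a * H1) * (x - m / a * H2) * (x - m / a * H3)) / x * G
       + a * (- (a + 1 / a) * x^2 + m * (c * (L1 + L2 + L3) + (H1 + H2 + H3)) * x
              + m^3 * (c^2 * (L1 * L2 * L3) + c * (H1 * H2 * H3)) / x)
     = m^2 * ((s - a * H1) * (s - a * H2) * (s - a * H3) / s / a^2 * G
       + c^2 * a^4 * ((s - L1 / a) * (s - L2 / a) * (s - L3 / a)) / s * F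
       + a * (- c * (a + 1 / a) * s^2 + c * ((H1 + H2 + H3) + (L1 + L2 + L3)) * s
              + (H1 * H2 * H3 + c^2 * (L1 * L2 * L3)) / s))"
proof -
  define M N where "M = m * c * a^2" and "N = m / a^2"
  have "(x - m * c * a * L1) * (x - m * c * a * L2) * (x - m * c * a * L3) / x
        - m^2 * (c^2 * a^4 * ((s - L1 / a) * (s - L2 / a) * (s - L3 / a)) / s)
      = (x - M * s) * (x + M * s - M * (L1 / a + L2 / a + L3 / a)
                       + M^2 * (L1 / a * (L2 / a) * (L3 / a)) / (x * s))"
  proof -
    have "m * c * a * L = M * (L / a)" for L
      using nz by (simp add: M_def power2_eq_square)
    moreover have "m^2 * (c^2 * a^4 * y / s) = M^2 * y / s" for y
      by (simp add: M_def power_mult_distrib)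
    ultimately show ?thesis
      by (simp only: cubic_difference_factor[OF nz(1,2)])
  qed
  then have F: "((x - m * c * a * L1) * (x - m * c * a * L2) * (x - m * c * a * L3) / x
        - m^2 * (c^2 * a^4 * ((s - L1 / a) * (s - L2 / a) * (s - L3 / a)) / s)) * F
      = (x - m * s) * (x + M * s - M * (L1 / a + L2 / a + L3 / a)
                       + M^2 * (L1 / a * (L2 / a) * (L3 / a)) / (x * s))"
    using pM by (simp add: F_def M_def)
  have "a^2 * ((x - m / a * H1) * (x - m / a * H2) * (x - m / a * H3)) / x
        - m^2 * ((s - a * H1) * (s - a * H2) * (s - a * H3) / s / a^2)
      = a^2 * ((x - N * s) * (x + N * s - N * (a * H1 + a * H2 + a * H3)
                       + N^2 * (a * H1 * (a * H2) * (a * H3)) / (x * s)))"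
  proof -
    have "m / a * H = N * (a * H)" for H
      using nz by (simp add: N_def power2_eq_square)
    moreover have "m^2 * (y / s / a^2) = a^2 * (N^2 * y / s)" for y
      using nz by (simp add: N_def field_simps)
    ultimately show ?thesis
      by (simp only: cubic_difference_factor[OF nz(1,2), symmetric] right_diff_distrib[of "a^2"]
            times_divide_eq_right)
  qed
  then have G: "(a^2 * ((x - m / a * H1) * (x - m / a * H2) * (x - m / a * H3)) / x
        - m^2 * ((s - a * H1) * (s - a * H2) * (s - a * H3) / s / a^2)) * G
      = a^2 * ((x - m * c * s) * (x + N * s - N * (a * H1 + a * H2 + a * H3)
                       + N^2 * (a * H1 * (a * H2) * (a * H3)) / (x * s)))"
    using pN by (simp add: G_def N_def)
  have "(x - m * s) * (x + M * s - M * (L1 / a + L2 / a + L3 / a)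
                       + M^2 * (L1 / a * (L2 / a) * (L3 / a)) / (x * s))
      + a^2 * ((x - m * c * s) * (x + N * s - N * (a * H1 + a * H2 + a * H3)
                       + N^2 * (a * H1 * (a * H2) * (a * H3)) / (x * s)))
      + a * (- (a + 1 / a) * x^2 + m * (c * (L1 + L2 + L3) + (H1 + H2 + H3)) * x
              + m^3 * (c^2 * (L1 * L2 * L3) + c * (H1 * H2 * H3)) / x)
     = m^2 * (a * (- c * (a + 1 / a) * s^2 + c * ((H1 + H2 + H3) + (L1 + L2 + L3)) * s
              + (H1 * H2 * H3 + c^2 * (L1 * L2 * L3)) / s))"
    using nz by (simp add: M_def N_def divide_simps) algebra
  moreover have "p * F + p' * G + r = k * (y' * G + y * F + r')"
    if "(p - k * y) * F = f" and "(p' - k * y') * G = g" and "f + g + r = k * r'"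
    for p p' y y' r r' k f g
    unfolding distrib_left that(3)[symmetric] that(1,2)[symmetric] by (simp add: algebra_simps)
  ultimately show ?thesis
    using F G by blast
qed

section \<open>The kernel identity for the operators\<close>

theorem theorem2p2:
  fixes q lq :: complex
    and t h l h' l' :: "nat \<Rightarrow> complex"
    and \<alpha> \<alpha>' \<beta> \<beta>' \<mu>0 \<mu> \<chi> \<nu> :: complex
    and X S :: "complex set" and Lx Ls :: "complex \<Rightarrow> complex"
    and D :: "(complex \<times> complex) set" and P :: "complex \<Rightarrow> complex \<Rightarrow> complex"
    and x s :: complex
  assumes "0 < norm q" and "norm q < 1" and "exp lq = q"
    and "q_log_branch q lq X Lx" and "q_log_branch q lq S Ls"
    and "\<chi> = (h' 1 + h' 2 + h' 3 - l' 1 - l' 2 - l' 3 - \<beta>') / 2"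
    and "\<nu> = 2 * \<mu>0 + \<alpha> - \<alpha>' + \<chi>"
    and "\<mu> = \<mu>0 + \<chi> + 1"
    and "\<beta> = - \<beta>' - \<chi>"
    and "\<And>i. i \<in> {1..3} \<Longrightarrow> l i = h' i + \<mu>0"
    and "\<And>i. i \<in> {1..3} \<Longrightarrow> h i = l' i + \<mu>0 + \<chi>"
    and "P_relations q lq \<mu> \<mu>0 D P"
    and "x \<in> X" and "s \<in> S"
    and "{(x, s), (q * x, s), (x / q, s), (x, q * s), (x, s / q)} \<subseteq> D"
    and "x - qpow lq (\<mu>0 - 1) * s \<noteq> 0" and "x - qpow lq \<mu> * s \<noteq> 0"
  shows "A3 q lq t h l \<alpha> \<beta>
           (\<lambda>y. branch_pow Lx y (- \<alpha>) * branch_pow Ls s (\<chi> + 1 - \<alpha>') * P y s) x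
       = qpow lq \<nu> * A3 q lq t h' l' \<alpha>' \<beta>'
           (\<lambda>r. branch_pow Lx x (- \<alpha>) * branch_pow Ls r (\<chi> + 1 - \<alpha>') * P x r) s"
proof -
  define a m c E E' where "a = qpow lq (1/2)" and "m = qpow lq \<mu>0" and "c = qpow lq \<chi>"
    and "E = qpow lq \<alpha>" and "E' = qpow lq \<alpha>'"
  define H L where "H n = qpow lq (h' n) * t n" and "L n = qpow lq (l' n) * t n" for n
  have nz: "a \<noteq> 0" "m \<noteq> 0" "c \<noteq> 0" "E \<noteq> 0" "E' \<noteq> 0" "q \<noteq> 0" "x \<noteq> 0" "s \<noteq> 0"
    using assms(1) q_log_branch_nonzero[OF assms(4,13)] q_log_branch_nonzero[OF assms(5,14)]
    by (auto simp: a_def m_def c_def E_def E'_def qpow_nonzero)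
  have q1: "qpow lq 1 = q"
    using assms(3) by (simp add: qpow_def)
  have qa: "q = a^2"
    using qpow_add[of lq "1/2" "1/2"] q1 by (simp add: a_def power2_eq_square)

  have mu: "qpow lq \<mu> = m * c * a^2" "qpow lq (\<mu> - 1) = m * c" "qpow lq (\<mu>0 - 1) = m / a^2"
    using nz by (simp_all add: assms(8) qpow_add qpow_diff q1 qa m_def c_def)
  have nu: "qpow lq \<nu> = m^2 * E / E' * c"
    by (simp add: assms(7) qpow_add qpow_diff qpow_numeral_mult m_def c_def E_def E'_def)
  have h: "qpow lq (h n) = qpow lq (l' n) * m * c" if "n \<in> {1..3}" for n
    using that by (simp add: assms(11) qpow_add m_def c_def)
  have l: "qpow lq (l n) = qpow lq (h' n) * m" if "n \<in> {1..3}" for n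
    using that by (simp add: assms(10) qpow_add m_def)

  define F G where "F = (x - m * s) / (x - m * c * a^2 * s)"
    and "G = (x - m * c * s) / (x - m / a^2 * s)"
  have P: "P (inverse q * x) s = F * P x s" "P x (q * s) = F * P x s"
    "P (q * x) s = G * P x s" "P x (inverse q * s) = G * P x s"
    using assms(12,15-17)
    by (auto simp: P_relations_def mu F_def G_def m_def[symmetric] inverse_eq_divide)

  \<comment> \<open>The factors \<open>1/2\<close> in the exponents cancel: \<open>\<beta>'\<close> equals \<open>\<Sum>h' - \<Sum>l' - 2\<chi>\<close>, and \<open>\<beta>\<close>
    equals \<open>-\<beta>' - \<chi>\<close>.\<close>
  have B: "qpow lq ((l 1 + l 2 + l 3 + h 1 + h 2 + h 3) / 2)
            * (qpow lq (\<beta> / 2) + qpow lq (- \<beta> / 2)) * t 1 * t 2 * t 3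
         = m^3 * (c^2 * (L 1 * L 2 * L 3) + c * (H 1 * H 2 * H 3))"
  proof -
    define e where "e = (l 1 + l 2 + l 3 + h 1 + h 2 + h 3) / 2"
    have b': "\<beta>' = h' 1 + h' 2 + h' 3 - l' 1 - l' 2 - l' 3 - 2 * \<chi>"
      using assms(6) by (simp add: field_simps)
    have "e + \<beta> / 2 = 3 * \<mu>0 + 2 * \<chi> + l' 1 + l' 2 + l' 3"
      and "e + - \<beta> / 2 = 3 * \<mu>0 + \<chi> + h' 1 + h' 2 + h' 3"
      by (auto simp: e_def b' assms(9,10,11) field_simps)
    then have "qpow lq e * (qpow lq (\<beta> / 2) + qpow lq (- \<beta> / 2))
        = qpow lq (3 * \<mu>0 + 2 * \<chi> + l' 1 + l' 2 + l' 3)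
        + qpow lq (3 * \<mu>0 + \<chi> + h' 1 + h' 2 + h' 3)"
      by (metis distrib_left qpow_add)
    then show ?thesis
      unfolding e_def[symmetric]
      by (simp add: qpow_add qpow_numeral_mult H_def L_def m_def c_def) (simp add: algebra_simps)
  qed
  have B': "c * (qpow lq ((l' 1 + l' 2 + l' 3 + h' 1 + h' 2 + h' 3) / 2)
            * (qpow lq (\<beta>' / 2) + qpow lq (- \<beta>' / 2)) * t 1 * t 2 * t 3)
         = H 1 * H 2 * H 3 + c^2 * (L 1 * L 2 * L 3)"
  proof -
    define e where "e = (l' 1 + l' 2 + l' 3 + h' 1 + h' 2 + h' 3) / 2"
    have "\<chi> + (e + \<beta>' / 2) = h' 1 + h' 2 + h' 3"
      and "\<chi> + (e + - \<beta>' / 2) = 2 * \<chi> + l' 1 + l' 2 + l' 3"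
      by (auto simp: e_def assms(6) field_simps)
    then have eq: "c * (qpow lq e * (qpow lq (\<beta>' / 2) + qpow lq (- \<beta>' / 2)))
        = qpow lq (h' 1 + h' 2 + h' 3) + qpow lq (2 * \<chi> + l' 1 + l' 2 + l' 3)"
      unfolding c_def by (metis distrib_left qpow_add)
    have "c * (qpow lq e * (qpow lq (\<beta>' / 2) + qpow lq (- \<beta>' / 2)) * t 1 * t 2 * t 3)
        = c * (qpow lq e * (qpow lq (\<beta>' / 2) + qpow lq (- \<beta>' / 2))) * (t 1 * t 2 * t 3)"
      by (simp only: mult.assoc)
    also have "\<dots> = H 1 * H 2 * H 3 + c^2 * (L 1 * L 2 * L 3)"
      unfolding eq
      by (simp add: qpow_add qpow_numeral_mult H_def L_def c_def) (simp add: algebra_simps)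
    finally show ?thesis
      unfolding e_def .
  qed

  define W where "W = branch_pow Lx x (- \<alpha>) * branch_pow Ls s (\<chi> + 1 - \<alpha>') * P x s"
  have ratio: "qpow lq (\<chi> + 1 - \<alpha>') = c * a^2 / E'"
    by (simp add: qpow_add qpow_diff q1 qa c_def E'_def)
  have half: "qpow lq (- 1 / 2) = 1 / a" "qpow lq (\<alpha> + 1/2) = E * a" "qpow lq (\<alpha>' + 1/2) = E' * a"
    "qpow lq (2 * \<alpha> + 1) = E^2 * a^2" "qpow lq (2 * \<alpha>' + 1) = E'^2 * a^2"
    using qpow_minus[of lq "1/2"]
    by (simp_all add: qpow_add qpow_numeral_mult q1 qa a_def E_def E'_def inverse_eq_divide)
  have roots: "qpow lq (h n + 1/2) * t n = m * c * a * L n" "qpow lq (l n - 1/2) * t n = m / a * H n"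
    "qpow lq (h' n + 1/2) * t n = a * H n" "qpow lq (l' n - 1/2) * t n = L n / a"
    "(qpow lq (h n) + qpow lq (l n)) * t n = m * (c * L n + H n)"
    "(qpow lq (h' n) + qpow lq (l' n)) * t n = H n + L n" if "n \<in> {1..3}" for n
    using that by (simp_all add: qpow_add qpow_diff h l H_def L_def a_def algebra_simps)

  have T: "branch_pow Lx (inverse q * x) (- \<alpha>) * branch_pow Ls s (\<chi> + 1 - \<alpha>') * P (inverse q * x) s
        = E * F * W"
    "branch_pow Lx (q * x) (- \<alpha>) * branch_pow Ls s (\<chi> + 1 - \<alpha>') * P (q * x) s = G * W / E"
    "branch_pow Lx x (- \<alpha>) * branch_pow Ls (inverse q * s) (\<chi> + 1 - \<alpha>') * P x (inverse q * s)
        = E' / (c * a^2) * G * W"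
    "branch_pow Lx x (- \<alpha>) * branch_pow Ls (q * s) (\<chi> + 1 - \<alpha>') * P x (q * s)
        = c * a^2 / E' * F * W"
    unfolding P branch_pow_shift[OF assms(4,13)] branch_pow_shift_inv[OF assms(4,13)]
      branch_pow_shift[OF assms(5,14)] branch_pow_shift_inv[OF assms(5,14)] ratio
      qpow_minus E_def[symmetric] W_def
    by (simp_all add: divide_inverse)
  have cubics:
    "(\<Prod>n=1..3. x - qpow lq (h n + 1/2) * t n)
        = (x - m * c * a * L 1) * (x - m * c * a * L 2) * (x - m * c * a * L 3)"
    "(\<Prod>n=1..3. x - qpow lq (l n - 1/2) * t n)
        = (x - m / a * H 1) * (x - m / a * H 2) * (x - m / a * H 3)"
    "(\<Prod>n=1..3. s - qpow lq (h' n + 1/2) * t n) = (s - a * H 1) * (s - a * H 2) * (s - a * H 3)"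
    "(\<Prod>n=1..3. s - qpow lq (l' n - 1/2) * t n) = (s - L 1 / a) * (s - L 2 / a) * (s - L 3 / a)"
    unfolding prod_1_3 by (simp_all add: roots)
  have sums:
    "(\<Sum>n=1..3. (qpow lq (h n) + qpow lq (l n)) * t n)
        = m * (c * (L 1 + L 2 + L 3) + (H 1 + H 2 + H 3))"
    "(\<Sum>n=1..3. (qpow lq (h' n) + qpow lq (l' n)) * t n) = (H 1 + H 2 + H 3) + (L 1 + L 2 + L 3)"
    unfolding sum_1_3 by (simp_all add: roots) (simp_all add: algebra_simps)

  have "inverse x * p * (E * F * W) + E^2 * a^2 * inverse x * p' * (G * W / E) + E * a * r * W
      = E * W * (p / x * F + a^2 * p' / x * G + a * r)" for p p' r
    using nz by (simp add: field_simps power2_eq_square)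
  then have "A3 q lq t h l \<alpha> \<beta>
           (\<lambda>y. branch_pow Lx y (- \<alpha>) * branch_pow Ls s (\<chi> + 1 - \<alpha>') * P y s) x
      = E * W * ((x - m * c * a * L 1) * (x - m * c * a * L 2) * (x - m * c * a * L 3) / x * F
       + a^2 * ((x - m / a * H 1) * (x - m / a * H 2) * (x - m / a * H 3)) / x * G
       + a * (- (a + 1 / a) * x^2 + m * (c * (L 1 + L 2 + L 3) + (H 1 + H 2 + H 3)) * x
              + m^3 * (c^2 * (L 1 * L 2 * L 3) + c * (H 1 * H 2 * H 3)) / x))"
    unfolding A3_def qshift_def qshift_inv_def T cubics sums B half W_def[symmetric] a_def[symmetric]
    by (simp only: divide_inverse)
  also have "\<dots> = E * W * (m^2 * ((s - a * H 1) * (s - a * H 2) * (s - a * H 3) / s / a^2 * G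
       + c^2 * a^4 * ((s - L 1 / a) * (s - L 2 / a) * (s - L 3 / a)) / s * F
       + a * (- c * (a + 1 / a) * s^2 + c * ((H 1 + H 2 + H 3) + (L 1 + L 2 + L 3)) * s
              + (H 1 * H 2 * H 3 + c^2 * (L 1 * L 2 * L 3)) / s)))"
    using cubic_kernel_identity[of x s a m c "L 1" "L 2" "L 3" "H 1" "H 2" "H 3"] nz assms(16,17)
    by (simp add: mu F_def G_def)
  also have "\<dots> = qpow lq \<nu> * A3 q lq t h' l' \<alpha>' \<beta>'
           (\<lambda>r. branch_pow Lx x (- \<alpha>) * branch_pow Ls r (\<chi> + 1 - \<alpha>') * P x r) s"
  proof -
    have "E * W * (m^2 * (p / s / a^2 * G + c^2 * a^4 * p' / s * F
            + a * (- c * (a + 1 / a) * s^2 + c * y * s + c * z / s)))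
        = m^2 * E / E' * c * (inverse s * p * (E' / (c * a^2) * G * W)
            + E'^2 * a^2 * inverse s * p' * (c * a^2 / E' * F * W)
            + E' * a * (- (a + 1 / a) * s^2 + y * s + z * inverse s) * W)" for p p' y z
      using nz by (simp add: field_simps power2_eq_square power4_eq_xxxx)
    then show ?thesis
      unfolding A3_def qshift_def qshift_inv_def T cubics sums B'[symmetric] half nu
        W_def[symmetric] a_def[symmetric]
      by (simp only:)
  qed
  finally show ?thesis .
qed

end
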